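(* For every real number $y\in\left(-1,-\frac12\right)$, the function $$x\mapsto x\psi(x+y+1)-\ln\Gamma(x+y+1)+\ln\Gamma(y+1)-\frac{x^2}{2(y+1)(x+y+1)}$$ is negative and decreasing with respect to $x\in\left[-\frac{2(y+1)^2}{1+2y},\infty\right)$.
   Context: $\Gamma(x)=\int_0^\infty u^{x-1}e^{-u}\,du$ for $x>0$ is the classical Euler gamma function, and $\psi(x)=\frac{\Gamma'(x)}{\Gamma(x)}$ for $x>0$ is its logarithmic derivative (the psi or digamma function). *)

theory Defs
  imports "HOL-Analysis.Analysis"
begin

text \<open>The library defines \<open>Gamma\<close> by its product formula and \<open>Digamma\<close> by a series.  On the
  positive reals they are Euler's integral and the logarithmic derivative of \<open>Gamma\<close>.\<close>

lemma Gamma_eq_Euler_integral: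
  fixes x :: real
  assumes "x > 0"
  shows "((\<lambda>u. u powr (x - 1) * exp (- u)) has_integral Gamma x) {0..}"
  using Gamma_integral_real[OF assms] by (simp add: exp_minus divide_inverse)

lemma Digamma_eq_log_deriv_Gamma:
  fixes x :: real
  assumes "x > 0"
  shows "Digamma x = deriv Gamma x / Gamma x"
proof -
  have "x \<notin> \<int>\<^sub>\<le>\<^sub>0"
    using assms by (auto elim!: nonpos_Ints_cases)
  then have "deriv Gamma x = Gamma x * Digamma x"
    by (intro DERIV_imp_deriv has_field_derivative_Gamma)
  then show ?thesis
    using Gamma_real_pos[OF assms] by simp
qed

definition psi_gamma_diff :: "real \<Rightarrow> real \<Rightarrow> real" where
  "psi_gamma_diff y x =
     x * Digamma (x + y + 1) - ln (Gamma (x + y + 1)) + ln (Gamma (y + 1))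
       - x ^ 2 / (2 * (y + 1) * (x + y + 1))"

end

theory Submission
  imports Defs "HOL-Real_Asymp.Real_Asymp"
begin

text \<open>Write \<open>a = y + 1\<close>, which lies in \<open>(0, 1/2)\<close>, and \<open>t = x + a\<close>. The derivative of the function is
  \<open>x (\<psi>'(t) - 1/(2 t\<^sup>2) - 1/(2 a t))\<close>. The left end point of the interval corresponds to
  \<open>t\<^sub>0 = a/(1 - 2 a)\<close>, and \<open>t \<ge> t\<^sub>0\<close> says exactly that \<open>1/(2 a) \<ge> 1 + 1/(2 t)\<close>. Hence the
  derivative is negative as soon as \<open>\<psi>'(t) < 1/t + 1/t\<^sup>2\<close>, and this holds for all \<open>t > 0\<close> (it is weaker
  than \<open>trigamma_less\<close>).

  It remains to see that the function is negative at the left end point. The function vanishes at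
  \<open>x = 0\<close> but first increases, so monotonicity does not help there. Without its last
  summand the function is \<open>\<integral>\<^bsub>a\<^esub>\<^bsup>t\<^esup> (s - a) \<psi>'(s) ds\<close>, and the bound \<open>\<psi>'(s) < 1/s + 1/s\<^sup>2\<close> is too
  weak for small \<open>a\<close>. The sharper \<open>\<psi>'(s) < 1/s\<^sup>2 + 1/(s + 1/2)\<close> suffices: with it, the integral is elementary
  (\<open>digamma_ln_Gamma_less\<close>), and at \<open>t\<^sub>0\<close> the resulting bound, with \<open>u = 2 a\<close>, is
  \<open>((1 + u) ln (1 + u) - (1 - u) ln (1 - u))/2 - u\<close>. This vanishes at \<open>u = 0\<close> and has the negative
  derivative \<open>ln (1 - u\<^sup>2)/2\<close>.\<close>

text \<open>The function \<open>1/(z - 1/2)\<close> drops by \<open>1/(z\<^sup>2 - 1/4)\<close> from \<open>z\<close> to \<open>z + 1\<close>, more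
  than the term \<open>1/z\<^sup>2\<close> of the trigamma series, so the series is dominated by a telescoping one.\<close>

lemma trigamma_less_inverse:
  fixes z :: real
  assumes "z > 1/2"
  shows "Polygamma 1 z < 1 / (z - 1/2)"
proof -
  let ?p = "\<lambda>k. inverse ((z + real k) ^ 2)"
  let ?h = "\<lambda>k. 1 / (z + real k - 1/2)"
  have p: "?p sums Polygamma 1 z"
    using Polygamma_LIMSEQ[of z 1] assms by (simp add: numeral_2_eq_2)
  have "?h \<longlonglongrightarrow> 0"
    by real_asymp
  then have h: "(\<lambda>k. ?h k - ?h (Suc k)) sums (1 / (z - 1/2))"
    using telescope_sums'[of ?h 0] by simp
  have pos: "?h k - ?h (Suc k) - ?p k > 0" for k
  proof -
    define w where "w = z + real k"
    have w: "w > 1/2"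
      using assms by (simp add: w_def)
    then have w2: "w ^ 2 > 1/4"
      using power_strict_mono[of "1/2" w 2] by (simp add: power2_eq_square)
    have "?h k - ?h (Suc k) = 1 / (w - 1/2) - 1 / (w + 1/2)"
      by (simp add: w_def algebra_simps)
    also have "\<dots> = 1 / (w ^ 2 - 1/4)"
      using w w2 by (simp add: field_simps power2_eq_square)
    also have "\<dots> > 1 / w ^ 2"
      using w2 by (intro divide_strict_left_mono mult_pos_pos) auto
    finally show ?thesis
      by (simp add: w_def inverse_eq_divide)
  qed
  have d: "(\<lambda>k. ?h k - ?h (Suc k) - ?p k) sums (1 / (z - 1/2) - Polygamma 1 z)"
    by (rule sums_diff[OF h p])
  have "0 < (\<Sum>k. ?h k - ?h (Suc k) - ?p k)"
    using d pos by (intro suminf_pos) (auto simp: sums_iff)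
  with d show ?thesis
    by (simp add: sums_iff)
qed

lemma trigamma_less:
  fixes s :: real
  assumes "s > 0"
  shows "Polygamma 1 s < 1 / s ^ 2 + 1 / (s + 1/2)"
  using Polygamma_plus1[of s 1] trigamma_less_inverse[of "s + 1"] assms
  by (simp add: numeral_2_eq_2 add.commute)

lemma has_derivative_digamma_ln_Gamma:
  fixes a s :: real
  assumes "s > 0"
  shows "((\<lambda>s. (s - a) * Digamma s - ln (Gamma s)) has_real_derivative (s - a) * Polygamma 1 s) (at s)"
proof -
  have s: "s \<notin> \<int>\<^sub>\<le>\<^sub>0"
    using assms by (auto elim!: nonpos_Ints_cases)
  show ?thesis
    by (rule derivative_eq_intros refl s Gamma_real_pos assms)+
      (use Gamma_real_pos[OF assms] in \<open>simp add: field_simps\<close>)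
qed

text \<open>Integrating \<open>(s - a) \<psi>'(s)\<close> by parts gives the left side, and the right side is the integral of
  \<open>(s - a) (1/s\<^sup>2 + 1/(s + 1/2))\<close>, both over \<open>[a, t]\<close>. So this is the integrated form of the trigamma
  bound; both sides vanish at \<open>t = a\<close>.\<close>

lemma digamma_ln_Gamma_less:
  fixes a t :: real
  assumes "0 < a" "a < t"
  shows "(t - a) * Digamma t - ln (Gamma t) + ln (Gamma a)
    < t - a + ln t - ln a - 1 + a / t - (a + 1/2) * (ln (t + 1/2) - ln (a + 1/2))"
proof -
  define D where "D s = (s - a + ln s + a / s - (a + 1/2) * ln (s + 1/2))
    - ((s - a) * Digamma s - ln (Gamma s))" for s
  define D' where "D' s = (s - a) * (1 / s ^ 2 + 1 / (s + 1/2) - Polygamma 1 s)" for s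
  have deriv: "(D has_real_derivative D' s) (at s)" if "s > 0" for s
  proof -
    have "((\<lambda>s. s - a + ln s + a / s - (a + 1/2) * ln (s + 1/2)) has_real_derivative
        1 + 1 / s - a / s ^ 2 - (a + 1/2) / (s + 1/2)) (at s)"
      using that by (auto intro!: derivative_eq_intros simp: power2_eq_square)
    also have "1 + 1 / s - a / s ^ 2 - (a + 1/2) / (s + 1/2) = (s - a) * (1 / s ^ 2 + 1 / (s + 1/2))"
    proof -
      have "1 - (a + 1/2) / (s + 1/2) = (s - a) / (s + 1/2)"
        using that by (simp add: field_simps)
      moreover have "1 / s - a / s ^ 2 = (s - a) / s ^ 2"
        using that by (simp add: field_simps power2_eq_square)
      ultimately show ?thesis
        by (simp add: distrib_left)
    qed
    finally show ?thesis
      using DERIV_diff[OF _ has_derivative_digamma_ln_Gamma[OF that, of a]]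
      unfolding D_def D'_def right_diff_distrib by blast
  qed
  have "D a < D t"
  proof (rule DERIV_pos_imp_increasing_open[OF assms(2)])
    show "\<exists>d. (D has_real_derivative d) (at s) \<and> d > 0" if "a < s" for s
      using deriv[of s] trigamma_less[of s] that assms(1) by (force simp: D'_def)
    show "continuous_on {a..t} D"
      by (intro DERIV_atLeastAtMost_imp_continuous_on) (meson deriv assms(1) less_le_trans)
  qed
  then show ?thesis
    using assms(1) by (simp add: D_def algebra_simps)
qed

text \<open>Near \<open>u = 0\<close> the two sides differ only by \<open>u\<^sup>3/3\<close> to leading order, but the derivative of the
  difference, \<open>ln (1 + u) + ln (1 - u) = ln (1 - u\<^sup>2)\<close>, has constant sign.\<close>

lemma log_one_plus_minus_less:
  fixes u :: real
  assumes "0 < u" "u < 1"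
  shows "(1 + u) * ln (1 + u) - (1 - u) * ln (1 - u) < 2 * u"
proof -
  let ?g = "\<lambda>u::real. (1 + u) * ln (1 + u) - (1 - u) * ln (1 - u) - 2 * u"
  have deriv: "(?g has_real_derivative ln (1 + v) + ln (1 - v)) (at v)" if "\<bar>v\<bar> < 1" for v
  proof -
    have "1 + v > 0" "1 - v > 0"
      using that by auto
    then show ?thesis
      by (auto intro!: derivative_eq_intros)
  qed
  have "?g u < ?g 0"
  proof (rule DERIV_neg_imp_decreasing_open[OF assms(1)])
    fix v :: real
    assume v: "0 < v" "v < u"
    have "ln (1 + v) + ln (1 - v) = ln ((1 + v) * (1 - v))"
      using v assms by (subst ln_mult) auto
    also have "\<dots> < 0"
    proof (rule ln_less_zero)
      show "(1 + v) * (1 - v) > 0"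
        using v assms by (intro mult_pos_pos) auto
      show "(1 + v) * (1 - v) < 1"
        using v by (simp add: algebra_simps)
    qed
    finally show "\<exists>d. (?g has_real_derivative d) (at v) \<and> d < 0"
      using deriv[of v] v assms by force
  next
    show "continuous_on {0..u} ?g"
      using deriv assms by (intro DERIV_atLeastAtMost_imp_continuous_on) force
  qed
  then show ?thesis
    by simp
qed

lemma has_derivative_psi_gamma_diff:
  fixes x y :: real
  assumes "y > -1" "x + y + 1 > 0"
  shows "(psi_gamma_diff y has_real_derivative
    x * (Polygamma 1 (x + y + 1) - 1 / (2 * (x + y + 1) ^ 2) - 1 / (2 * (y + 1) * (x + y + 1)))) (at x)"
proof -
  define a t where "a = y + 1" and "t = x + y + 1"
  have at: "a > 0" "t > 0" "x = t - a"
    using assms by (auto simp: a_def t_def)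
  have "((\<lambda>s. (s - a) * Digamma s - ln (Gamma s) + ln (Gamma a) - (s - a) ^ 2 / (2 * a * s))
      has_real_derivative (t - a) * Polygamma 1 t
        - (2 * (t - a) * (2 * a * t) - (t - a) ^ 2 * (2 * a)) / (2 * a * t) ^ 2) (at t)"
  proof (rule DERIV_diff)
    show "((\<lambda>s. (s - a) * Digamma s - ln (Gamma s) + ln (Gamma a)) has_real_derivative
        (t - a) * Polygamma 1 t) (at t)"
      using DERIV_add[OF has_derivative_digamma_ln_Gamma[OF at(2), of a] DERIV_const] by simp
    show "((\<lambda>s. (s - a) ^ 2 / (2 * a * s)) has_real_derivative
        (2 * (t - a) * (2 * a * t) - (t - a) ^ 2 * (2 * a)) / (2 * a * t) ^ 2) (at t)"
      using at(1,2) by (auto intro!: derivative_eq_intros simp: power2_eq_square)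
  qed
  also have "(t - a) * Polygamma 1 t
        - (2 * (t - a) * (2 * a * t) - (t - a) ^ 2 * (2 * a)) / (2 * a * t) ^ 2
      = x * (Polygamma 1 t - 1 / (2 * t ^ 2) - 1 / (2 * a * t))"
    unfolding at(3) using at(1,2) by (simp add: divide_simps) (simp add: algebra_simps power2_eq_square)
  finally have "((\<lambda>s. (s - a) * Digamma s - ln (Gamma s) + ln (Gamma a) - (s - a) ^ 2 / (2 * a * s))
      has_real_derivative x * (Polygamma 1 t - 1 / (2 * t ^ 2) - 1 / (2 * a * t))) (at (x + a))"
    using at(3) by simp
  from DERIV_shift[THEN iffD1, OF this] show ?thesis
    by (simp add: psi_gamma_diff_def[abs_def] a_def t_def add.assoc add.left_commute)
qed

theorem theorem2:
  fixes y :: real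
  assumes "y \<in> {-1 <..< -1/2}"
  shows "(\<forall>x \<in> {- (2 * (y + 1) ^ 2 / (1 + 2 * y)) ..}. psi_gamma_diff y x < 0) \<and>
         strict_antimono_on {- (2 * (y + 1) ^ 2 / (1 + 2 * y)) ..} (psi_gamma_diff y)"
proof -
  define a where "a = y + 1"
  define x\<^sub>0 where "x\<^sub>0 = - (2 * (y + 1) ^ 2 / (1 + 2 * y))"
  define t\<^sub>0 where "t\<^sub>0 = a / (1 - 2 * a)"
  have a: "0 < a" "a < 1/2"
    using assms by (auto simp: a_def)
  have t\<^sub>0: "x\<^sub>0 + a = t\<^sub>0" "t\<^sub>0 > 0"
  proof -
    have "x\<^sub>0 = 2 * a ^ 2 / (1 - 2 * a)"
      using a by (simp add: x\<^sub>0_def a_def divide_simps) (simp add: algebra_simps)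
    then show "x\<^sub>0 + a = t\<^sub>0"
      using a by (simp add: t\<^sub>0_def field_simps power2_eq_square)
    show "t\<^sub>0 > 0"
      using a by (simp add: t\<^sub>0_def)
  qed
  have x\<^sub>0: "x\<^sub>0 = 2 * a * t\<^sub>0"
    using t\<^sub>0(1) a by (simp add: t\<^sub>0_def field_simps)
  have x\<^sub>0_pos: "x\<^sub>0 > 0"
    using a t\<^sub>0 by (simp add: x\<^sub>0)

  have decreasing: "psi_gamma_diff y x' < psi_gamma_diff y x" if "x\<^sub>0 \<le> x" "x < x'" for x x'
  proof (rule DERIV_neg_imp_decreasing[OF that(2)])
    fix z
    assume "x \<le> z" "z \<le> x'"
    then have z: "z \<ge> x\<^sub>0" "z > 0"
      using that x\<^sub>0_pos by auto
    define t where "t = z + y + 1"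
    have t: "t \<ge> t\<^sub>0" "t > 0"
      using z t\<^sub>0 by (auto simp: t_def a_def)
    \<comment> \<open>The left end point of the interval is chosen for this: \<open>t\<^sub>0\<close> is the value of \<open>t\<close> where
        equality holds, here and in the comparison with \<open>1/t + 1/t\<^sup>2\<close> below.\<close>
    have "a \<le> t * (1 - 2 * a)"
      using t(1) a by (simp add: t\<^sub>0_def field_simps)
    then have "0 \<le> (t * (1 - 2 * a) - a) / (2 * a * t ^ 2)"
      using a by simp
    also have "\<dots> = 1 / (2 * t ^ 2) + 1 / (2 * a * t) - (1 / t + 1 / t ^ 2)"
      using a t(2) by (simp add: field_simps power2_eq_square)
    finally have "1 / t + 1 / t ^ 2 \<le> 1 / (2 * t ^ 2) + 1 / (2 * a * t)"
      by simp
    moreover have "1 / (t + 1/2) < 1 / t"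
      using t(2) by (simp add: field_simps)
    ultimately have "Polygamma 1 t - 1 / (2 * t ^ 2) - 1 / (2 * a * t) < 0"
      using trigamma_less[OF t(2)] by linarith
    then have "z * (Polygamma 1 t - 1 / (2 * t ^ 2) - 1 / (2 * a * t)) < 0"
      using z(2) by (rule mult_pos_neg[rotated])
    moreover have "(psi_gamma_diff y has_real_derivative
        z * (Polygamma 1 t - 1 / (2 * t ^ 2) - 1 / (2 * a * t))) (at z)"
      using has_derivative_psi_gamma_diff[of y z] assms t(2) by (simp add: t_def a_def)
    ultimately show "\<exists>d. (psi_gamma_diff y has_real_derivative d) (at z) \<and> d < 0"
      by blast
  qed

  have endpoint: "psi_gamma_diff y x\<^sub>0 < 0"
  proof -
    define u where "u = 2 * a"
    have u: "0 < u" "u < 1"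
      using a by (auto simp: u_def)
    \<comment> \<open>The rational last summand cancels the linear part \<open>t\<^sub>0 - a\<close> in the bound
        of \<open>digamma_ln_Gamma_less\<close>.\<close>
    have "x\<^sub>0 ^ 2 / (2 * a * t\<^sub>0) = x\<^sub>0"
      using x\<^sub>0 x\<^sub>0_pos by (simp add: power2_eq_square flip: x\<^sub>0)
    moreover have "t\<^sub>0 - a = x\<^sub>0" "x\<^sub>0 + y + 1 = t\<^sub>0"
      using t\<^sub>0(1) by (auto simp: a_def)
    ultimately have "psi_gamma_diff y x\<^sub>0
        = (t\<^sub>0 - a) * Digamma t\<^sub>0 - ln (Gamma t\<^sub>0) + ln (Gamma a) - (t\<^sub>0 - a)"
      by (simp only: psi_gamma_diff_def flip: a_def)
    also have "\<dots> < ln t\<^sub>0 - ln a - 1 + a / t\<^sub>0 - (a + 1/2) * (ln (t\<^sub>0 + 1/2) - ln (a + 1/2))"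
      using digamma_ln_Gamma_less[of a t\<^sub>0] a x\<^sub>0_pos t\<^sub>0(1) by linarith
    also have "\<dots> = ((1 + u) * ln (1 + u) - (1 - u) * ln (1 - u)) / 2 - u"
    proof -
      have 1: "ln t\<^sub>0 - ln a = - ln (1 - u)"
        using a u(2) by (simp add: t\<^sub>0_def u_def ln_div)
      have 2: "a / t\<^sub>0 = 1 - u"
        using a by (simp add: t\<^sub>0_def u_def)
      have 3: "ln (t\<^sub>0 + 1/2) - ln (a + 1/2) = - ln (1 - u) - ln (1 + u)"
      proof -
        have half: "t\<^sub>0 + 1/2 = (1/2) / (1 - u)" "a + 1/2 = (1 + u) / 2"
          using a by (auto simp: t\<^sub>0_def u_def divide_simps)
        have "ln ((1/2) / (1 - u)) = - ln 2 - ln (1 - u)"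
          using u(2) by (subst ln_div) (auto simp: ln_div)
        moreover have "ln ((1 + u) / 2) = ln (1 + u) - ln 2"
          using u(1) by (subst ln_div) auto
        ultimately show ?thesis
          unfolding half by simp
      qed
      show ?thesis
        unfolding 1 2 3 by (simp add: u_def field_simps)
    qed
    also have "\<dots> < 0"
      using log_one_plus_minus_less[OF u] by simp
    finally show ?thesis .
  qed

  have "psi_gamma_diff y x < 0" if "x \<ge> x\<^sub>0" for x
    using endpoint decreasing[of x\<^sub>0 x] that by (cases "x = x\<^sub>0") auto
  moreover have "strict_antimono_on {x\<^sub>0..} (psi_gamma_diff y)"
    by (rule monotone_onI) (use decreasing in auto)
  ultimately show ?thesis
    unfolding x\<^sub>0_def by auto
qed

end
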